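(* For any finite group $G$ of order $n > 1$, there is a generating pair $S_1, S_2$ for $G$ such that $|S_1| \le \lceil \sqrt{n \ln n}\,\rceil$ and $|S_2| \le \lceil \sqrt{n \ln n}\,\rceil$.
   Context: For a group $G$, a pair of subsets $S_1, S_2 \subseteq G$ is a generating pair for $G$ if $S_1 S_2 := \{xy : x \in S_1, y \in S_2\}$ equals $G$. The group $G$ need not be abelian. *)

theory Defs
  imports Complex_Main "HOL-Algebra.Coset"
begin

definition generating_pair :: "('a, 'b) monoid_scheme \<Rightarrow> 'a set \<Rightarrow> 'a set \<Rightarrow> bool" where
  "generating_pair G S1 S2 \<longleftrightarrow>
     S1 \<subseteq> carrier G \<and> S2 \<subseteq> carrier G \<and> S1 <#>\<^bsub>G\<^esub> S2 = carrier G"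

end

theory Submission
  imports Defs
begin

text \<open>
  Let \<open>k = \<lceil>sqrt (n ln n)\<rceil>\<close> and take for \<open>S\<^sub>1\<close> any subset of size \<open>k\<close>. A uniformly random right
  translate of \<open>S\<^sub>1\<close> covers each element with probability \<open>k / n\<close>, so some translate covers at
  least this proportion of the elements not covered so far. After \<open>k\<close> greedy choices at most
  \<open>n (1 - k / n)^k < n exp (- k\<^sup>2 / n) \<le> 1\<close> elements remain uncovered, that is, none.
\<close>

text \<open>For each \<open>s\<close> in \<open>S\<close> the equation
  \<open>u = s \<otimes> x\<close> has the single solution \<open>x = inv s \<otimes> u\<close>, and
  distinct \<open>s\<close> give distinct solutions.\<close>

lemma (in group) card_translates_containing:
  assumes "S \<subseteq> carrier G" and "u \<in> carrier G"
  shows "card {x \<in> carrier G. u \<in> S #> x} = card S"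
proof -
  have "{x \<in> carrier G. u \<in> S #> x} = (\<lambda>s. inv s \<otimes> u) ` S"
  proof (intro equalityI subsetI)
    fix x assume "x \<in> {x \<in> carrier G. u \<in> S #> x}"
    then obtain s where "x \<in> carrier G" "s \<in> S" "u = s \<otimes> x"
      by (auto simp: r_coset_def)
    moreover from this assms have "x = inv s \<otimes> u"
      by (metis inv_solve_left subsetD)
    ultimately show "x \<in> (\<lambda>s. inv s \<otimes> u) ` S"
      by blast
  next
    fix x assume "x \<in> (\<lambda>s. inv s \<otimes> u) ` S"
    then obtain s where s: "s \<in> S" "x = inv s \<otimes> u"
      by blast
    with assms have "s \<in> carrier G"
      by blast
    with s assms have "x \<in> carrier G" "u = s \<otimes> x"
      by (auto simp flip: m_assoc)
    with s show "x \<in> {x \<in> carrier G. u \<in> S #> x}"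
      by (auto simp: r_coset_def)
  qed
  moreover have "inj_on (\<lambda>s. inv s \<otimes> u) S"
    using assms by (intro inj_onI) (metis inv_closed inv_inv right_cancel subsetD)
  ultimately show ?thesis
    by (simp add: card_image)
qed

text \<open>An averaging argument: some translate does at least as well as the mean over all
  \<open>x\<close>. The inequality is multiplied out so that it stays within the natural
  numbers.\<close>

lemma (in group) exists_translate_covering_proportion:
  assumes "finite (carrier G)" and "S \<subseteq> carrier G" and "U \<subseteq> carrier G"
  shows "\<exists>x\<in>carrier G. card U * card S \<le> card (U \<inter> (S #> x)) * order G"
proof (rule ccontr)
  assume "\<not> ?thesis"
  then have less: "card (U \<inter> (S #> x)) * order G < card U * card S" if "x \<in> carrier G" for x
    using that by (meson not_le)
  have "finite U"
    using assms finite_subset by blast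
  \<comment> \<open>Double counting of the pairs \<open>(x, u)\<close> with
    \<open>u \<in> S #> x\<close>: each \<open>u\<close> lies in exactly \<open>card S\<close>
    translates.\<close>
  have "(\<Sum>x\<in>carrier G. card {u \<in> U. u \<in> S #> x}) = card S * card U"
    using assms \<open>finite U\<close> by (intro sum_multicount) (auto intro: card_translates_containing)
  moreover have "{u \<in> U. u \<in> S #> x} = U \<inter> (S #> x)" for x
    by blast
  ultimately have "(\<Sum>x\<in>carrier G. card (U \<inter> (S #> x)) * order G) = card U * card S * order G"
    by (simp flip: sum_distrib_right)
  \<comment> \<open>The right-hand sum is also \<open>card U * card S * order G\<close>, so
    strictness is the contradiction.\<close>
  moreover have "(\<Sum>x\<in>carrier G. card (U \<inter> (S #> x)) * order G)
      < (\<Sum>x\<in>carrier G. card U * card S)"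
    using assms(1) less by (intro sum_strict_mono) auto
  ultimately show False
    by (simp add: order_def)
qed

text \<open>Adding \<open>x\<close> to \<open>T\<close> adds the translate \<open>S #> x\<close> to
  the covered set; the best \<open>x\<close> shrinks the uncovered set by the factor
  \<open>1 - card S / order G\<close> or better.\<close>

lemma (in group) greedy_covering:
  assumes fin: "finite (carrier G)" and S: "S \<subseteq> carrier G"
  shows "\<exists>T \<subseteq> carrier G. card T \<le> t \<and>
    real (card (carrier G - (S <#> T))) \<le> order G * (1 - card S / order G) ^ t"
proof (induction t)
  case 0
  then show ?case
    by (intro exI[of _ "{}"]) (simp add: set_mult_def order_def)
next
  case (Suc t)
  define q where "q = 1 - real (card S) / order G"
  have pos: "order G > 0"
    using fin order_gt_0_iff_finite by blast
  have "card S \<le> order G"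
    using fin S by (simp add: order_def card_mono)
  then have "q \<ge> 0"
    using pos by (simp add: q_def)
  from Suc obtain T where T: "T \<subseteq> carrier G" "card T \<le> t"
      "real (card (carrier G - (S <#> T))) \<le> order G * q ^ t"
    unfolding q_def by blast
  define U where "U = carrier G - (S <#> T)"
  have "finite U"
    using fin by (simp add: U_def)
  obtain x where x: "x \<in> carrier G" "card U * card S \<le> card (U \<inter> (S #> x)) * order G"
    using exists_translate_covering_proportion[OF fin S, of U] by (auto simp: U_def)
  have "S <#> insert x T = (S <#> T) \<union> (S #> x)"
    by (auto simp: set_mult_def r_coset_def)
  then have "carrier G - (S <#> insert x T) = U - (U \<inter> (S #> x))"
    by (auto simp: U_def)
  then have "real (card (carrier G - (S <#> insert x T))) = card U - real (card (U \<inter> (S #> x)))"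
    using \<open>finite U\<close> by (simp add: card_Diff_subset of_nat_diff card_mono)
  \<comment> \<open>Not a link of the chain: this is the choice of \<open>x\<close>, cast to the
    reals, from which the next inequality follows on division by \<open>order G\<close>.\<close>
  also have "real (card U * card S) \<le> real (card (U \<inter> (S #> x)) * order G)"
    using x(2) by (rule of_nat_mono)
  then have "card U - real (card (U \<inter> (S #> x))) \<le> card U * q"
    using pos by (simp add: q_def field_simps)
  also have "\<dots> \<le> order G * q ^ t * q"
    using T(3) \<open>q \<ge> 0\<close> by (intro mult_right_mono) (simp_all add: U_def)
  finally have "real (card (carrier G - (S <#> insert x T))) \<le> order G * q ^ Suc t"
    by (simp add: mult_ac)
  moreover have "card (insert x T) \<le> Suc t"
    using T(2) card_insert_le_m1[of "Suc t" T x] by simp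
  ultimately show ?case
    using T(1) x(1) unfolding q_def by blast
qed

text \<open>Strictness comes from \<open>1 - x < exp (- x)\<close> at \<open>x = k / n > 0\<close>;
  it survives the power because \<open>k \<le> n\<close> keeps the base nonnegative and
  \<open>k > 0\<close>.\<close>

lemma covering_bound_less_1:
  fixes n k :: nat
  assumes "0 < n" "0 < k" "k \<le> n" and "n * ln n \<le> real k ^ 2"
  shows "n * (1 - k / n) ^ k < (1::real)"
proof -
  have "1 - k / n < exp (- (real k / n))"
    using exp_minus_greater[of "real k / n"] assms by simp
  then have "(1 - k / n) ^ k < exp (- (real k / n)) ^ k"
    using assms by (intro power_strict_mono) auto
  also have "\<dots> = exp (- (real k ^ 2 / n))"
    by (simp flip: exp_of_nat_mult add: power2_eq_square)
  also have "\<dots> \<le> exp (- ln n)"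
    using assms by (simp add: field_simps)
  also have "\<dots> = 1 / n"
    using assms by (simp add: exp_minus field_simps)
  finally show ?thesis
    using assms by (simp add: field_simps)
qed

theorem theorem8:
  fixes G :: "('a, 'b) monoid_scheme" and n :: nat
  assumes "group G"
    and "finite (carrier G)"
    and "order G = n"
    and "n > 1"
  shows "\<exists>S1 S2. generating_pair G S1 S2
           \<and> int (card S1) \<le> \<lceil>sqrt (real n * ln (real n))\<rceil>
           \<and> int (card S2) \<le> \<lceil>sqrt (real n * ln (real n))\<rceil>"
proof -
  interpret group G
    by fact
  define r where "r = sqrt (n * ln n)"
  define k where "k = nat \<lceil>r\<rceil>"
  have "r > 0"
    using assms by (simp add: r_def)
  then have k: "int k = \<lceil>r\<rceil>" "0 < k" "r \<le> k"
    by (simp_all add: k_def)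
  \<comment> \<open>This leads to \<open>k \<le> n\<close>, so that a subset of size
    \<open>k\<close> exists and \<open>covering_bound_less_1\<close> applies.\<close>
  have "n * ln n \<le> real n ^ 2"
    using ln_le_minus_one[of n] assms by (simp add: power2_eq_square)
  then have "r \<le> n"
    using real_le_lsqrt by (simp add: r_def)
  then have "k \<le> n"
    by (simp add: k_def ceiling_le_iff nat_le_iff)
  have "n * ln n = r ^ 2"
    using assms by (simp add: r_def)
  also have "\<dots> \<le> real k ^ 2"
    using k \<open>r > 0\<close> by (intro power_mono) auto
  finally have bound: "n * (1 - k / n) ^ k < (1::real)"
    using assms k \<open>k \<le> n\<close> by (intro covering_bound_less_1) auto
  obtain S where S: "S \<subseteq> carrier G" "card S = k"
    using \<open>k \<le> n\<close> assms obtain_subset_with_card_n[of k "carrier G"] by (auto simp: order_def)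
  obtain T where T: "T \<subseteq> carrier G" "card T \<le> k"
      "card (carrier G - (S <#>\<^bsub>G\<^esub> T)) \<le> n * (1 - k / n) ^ k"
    using greedy_covering[OF assms(2) S(1), of k] S(2) assms(3) by auto
  \<comment> \<open>A natural number below 1 vanishes.\<close>
  have "card (carrier G - (S <#>\<^bsub>G\<^esub> T)) = 0"
    using T(3) bound by linarith
  then have "S <#>\<^bsub>G\<^esub> T = carrier G"
    using assms(2) set_mult_closed[OF S(1) T(1)] by auto
  then have "generating_pair G S T"
    using S T by (simp add: generating_pair_def)
  moreover have "int (card S) \<le> \<lceil>r\<rceil>" "int (card T) \<le> \<lceil>r\<rceil>"
    using S T k by linarith+
  ultimately show ?thesis
    unfolding r_def by blast
qed

end
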